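(* There exist an absolute constant $c_0>0$ and a sequence of arithmetical progressions $a_k \pmod{m_k}$, $k\ge 1$ (with $a_k$ integers and $m_k$ positive integers), with $m_k\to\infty$ as $k\to\infty$, such that for every $k$ the progression $a_k\pmod{m_k}$ contains a totient (that is, $N(a_k,m_k)$ exists) and $$N(a_k,m_k)\ \ge\ m_k^{(c_0+o(1))\left(\log\log m_k/\log\log\log m_k\right)^{1/2}}\qquad\text{as } k\to\infty .$$
   Context: $\phi$ denotes the Euler function, and a totient is a value $\phi(n)$ with $n$ a positive integer. For integers $a$ and $m\ge 1$ such that the residue class $a\pmod m$ contains at least one totient, $N(a,m)$ denotes the smallest totient in the residue class $a\pmod m$; if the class contains no totient, $N(a,m)$ does not exist. $\log$ is the natural logarithm. The term $o(1)$ denotes a quantity tending to $0$ as $k\to\infty$. *)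

theory Defs
  imports Complex_Main "HOL-Number_Theory.Number_Theory"
begin

(* The condition n > 0 matters: the library sets totient 0 = 0, and 0 is not a totient. *)
definition is_totient :: "nat \<Rightarrow> bool" where
  "is_totient t \<longleftrightarrow> (\<exists>n>0. t = totient n)"

definition totients_in_class :: "int \<Rightarrow> nat \<Rightarrow> nat set" where
  "totients_in_class a m = {t. is_totient t \<and> [int t = a] (mod int m)}"

(* Meaningful only if totients_in_class a m is nonempty; unspecified otherwise. *)
definition least_totient :: "int \<Rightarrow> nat \<Rightarrow> nat" where
  "least_totient a m = (LEAST t. t \<in> totients_in_class a m)"

end

theory Submission
  imports Defs "HOL-Computational_Algebra.Computational_Algebra"
begin

text \<open>
  Fix a large prime $p \equiv 3 \pmod 4$ and let $a = p^e(p-1)$ with $p^{e+1} \equiv 1$ modulo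
  $V = (p-1)^3(2p-1)W$, and $m = p^6 V$ with $W < p$, so that $a \equiv 1 - 1/p \pmod V$.
  A totient $t \equiv a \pmod m$ is $2$ modulo $4$, hence $t = q^f(q-1)$ with $q$ prime. If
  $f = 0$, then $2p-1$ divides $q$, so $t = 2p-2$ is divisible by $4$, a contradiction. If $q = p$,
  the factor $(p-1)^3$ forces $(p-1) \mid f+1$; if $q \neq p$, the factor $p^6$ forces
  $q \equiv 1 \pmod{p^6}$. So $t$ is a high power of $m$ unless $0 < f < L$, and for these $f$
  the modulus $W$ is chosen such that $x^f(x-1) \equiv 1 - 1/p \pmod W$ is not solvable.

  Such $W$ and $p$ are found by averaging over $p$: modulo a prime $r$ the map
  $x \mapsto x^f(x-1)$ misses a proportion of at least $1/(4L)$ of the residues, so only a tiny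
  proportion of the integers up to $2^i$ is bad for all $r$ in a set of $20 L^2$ primes, while the
  primes congruent to $3$ modulo $4$ have density at least $1/(i+1)^2$ for infinitely many $i$,
  because the sum of their reciprocals diverges.
\<close>

subsection \<open>Counting\<close>

lemma squarefree_eq_prod_prime_factors:
  fixes n :: nat
  assumes "squarefree n"
  shows "n = \<Prod>(prime_factors n)"
proof -
  have n0: "n \<noteq> 0" using assms by (metis not_squarefree_0)
  have "multiplicity p n = 1" if "p \<in> prime_factors n" for p
    using assms that n0 squarefree_factorial_semiring''[OF n0]
    by (auto simp: prime_factors_multiplicity intro!: le_antisym)
  then have "(\<Prod>p\<in>prime_factors n. p ^ multiplicity p n) = (\<Prod>p\<in>prime_factors n. p)"
    by (intro prod.cong) auto
  with prod_prime_factors[OF n0] show ?thesis by simp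
qed

text \<open>Erdos: an integer is determined by its square part and the primes dividing its squarefree part.\<close>

lemma card_primes_le_four_pow: "k \<le> card {p::nat. prime p \<and> p \<le> 4 ^ k}"
proof -
  define P where "P = {p::nat. prime p \<and> p \<le> 4 ^ k}"
  have finP: "finite P" by (rule finite_subset[of _ "{..4^k}"]) (auto simp: P_def)
  define f where "f = (\<lambda>n::nat. (square_part n, prime_factors (squarefree_part n)))"
  have inj: "inj_on f {1..4^k}"
  proof (rule inj_onI)
    fix a b assume "f a = f b"
    then have 1: "square_part a = square_part b"
      and 2: "prime_factors (squarefree_part a) = prime_factors (squarefree_part b)"
      by (auto simp: f_def)
    have "squarefree_part a = squarefree_part b"
      by (metis 2 squarefree_eq_prod_prime_factors squarefree_squarefree_part)
    with 1 show "a = b" by (metis squarefree_decompose)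
  qed
  have "f ` {1..4^k} \<subseteq> {1..2^k} \<times> Pow P"
  proof safe
    fix n :: nat and x y assume n: "n \<in> {1..4^k}" and xy: "(x, y) = f n"
    have dec: "n = squarefree_part n * square_part n ^ 2" by (rule squarefree_decompose)
    have sp: "square_part n > 0" using n by (intro gr0I) auto
    have "x ^ 2 \<le> n" using dec xy n by (auto simp: f_def intro: dvd_imp_le)
    also have "\<dots> \<le> (2^k)^2" using n by (simp add: power_mult[symmetric] power2_eq_square power_mult_distrib[symmetric])
    finally have "x \<le> 2^k" by (rule power2_le_imp_le) simp
    then show "x \<in> {1..2^k}" using sp xy by (simp add: f_def)
    fix p assume p: "p \<in> y"
    then have "prime p" "p dvd squarefree_part n" using xy by (auto simp: f_def)
    then have "p dvd n" using dec by (metis dvd_mult2)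
    then have "p \<le> n" using n by (auto intro: dvd_imp_le)
    then show "p \<in> P" using n \<open>prime p\<close> by (auto simp: P_def)
  qed
  \<comment> \<open>There are at most \<open>2 ^ k\<close> square parts and
    \<open>2 ^ card P\<close> sets of primes, and together they must distinguish
    \<open>4 ^ k\<close> integers.\<close>
  then have "card {1..(4::nat)^k} \<le> card ({1..(2::nat)^k} \<times> Pow P)"
    using inj finP by (intro card_inj_on_le[of f]) auto
  then have "(4::nat)^k \<le> 2^k * 2^card P"
    by (simp add: card_cartesian_product card_Pow finP)
  moreover have "(4::nat)^k = 2^k * 2^k" by (simp flip: power_mult_distrib)
  ultimately have "(2::nat)^k \<le> 2 ^ card P" by simp
  then show ?thesis unfolding P_def by (rule power_le_imp_le_exp[rotated]) simp
qed

section \<open>Counting points of periodic sets\<close>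

lemma card_periodic:
  fixes P :: "nat \<Rightarrow> bool"
  assumes "\<And>n. P (n + D) = P n"
  shows "card {n. n < D * N \<and> P n} = N * card {n. n < D \<and> P n}"
proof (induction N)
  case 0
  then show ?case by simp
next
  case (Suc N)
  have per: "P (n + D * N) = P n" for n N
  proof (induction N)
    case (Suc N)
    have "n + D * Suc N = (n + D * N) + D" by simp
    then show ?case using Suc assms by metis
  qed simp
  have split: "{n. n < D * Suc N \<and> P n} =
      {n. n < D * N \<and> P n} \<union> (\<lambda>n. n + D * N) ` {n. n < D \<and> P n}" (is "?A = ?B \<union> ?C")
  proof (intro equalityI subsetI)
    fix n assume n: "n \<in> ?A"
    show "n \<in> ?B \<union> ?C"
    proof (cases "n < D * N")
      case False
      then obtain m where "n = m + D * N" by (metis add.commute le_Suc_ex not_less)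
      then show ?thesis using n per by auto
    qed (use n in auto)
  next
    fix n assume "n \<in> ?B \<union> ?C"
    then show "n \<in> ?A" using per by auto
  qed
  have "card ?A = card ?B + card ?C"
    unfolding split by (rule card_Un_disjoint) auto
  also have "card ?C = card {n. n < D \<and> P n}"
    by (rule card_image) (simp add: inj_on_def)
  finally show ?case using Suc by simp
qed

lemma card_periodic_le:
  fixes P :: "nat \<Rightarrow> bool"
  assumes "\<And>n. P (n + D) = P n" "D > 0"
  shows "card {n. n \<le> x \<and> P n} \<le> (x div D + 1) * card {n. n < D \<and> P n}"
proof -
  have "x < D * (x div D + 1)" using assms(2) by (simp add: dividend_less_times_div)
  then have "card {n. n \<le> x \<and> P n} \<le> card {n. n < D * (x div D + 1) \<and> P n}"
    by (intro card_mono) auto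
  then show ?thesis using card_periodic[of P D "x div D + 1", OF assms(1)] by argo
qed

subsection \<open>Primes congruent to 3 modulo 4\<close>

definition primes_3_mod_4 :: "nat \<Rightarrow> nat set" where
  "primes_3_mod_4 x = {p. prime p \<and> p mod 4 = 3 \<and> p \<le> x}"

lemma finite_primes_3_mod_4 [simp]: "finite (primes_3_mod_4 x)"
  by (rule finite_subset[of _ "{..x}"]) (auto simp: primes_3_mod_4_def)

text \<open>If \<open>n = p * k\<close> is 3 modulo 4, then exactly one of \<open>p\<close> and
  \<open>k\<close> is 3 and the other is 1; induction on \<open>n\<close> handles the case where it
  is the cofactor \<open>k\<close>.\<close>

lemma prime_factor_3_mod_4:
  fixes n :: nat
  assumes "n mod 4 = 3"
  shows "\<exists>p. prime p \<and> p mod 4 = 3 \<and> p dvd n"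
  using assms
proof (induction n rule: less_induct)
  case (less n)
  then have "n \<noteq> 1" "n > 0" by (auto intro: gr0I)
  then obtain p where p: "prime p" "p dvd n" using prime_factor_nat by blast
  then obtain k where k: "n = p * k" by auto
  have prod: "((p mod 4) * (k mod 4)) mod 4 = 3" using less.prems k by (simp add: mod_mult_eq)
  have "p mod 4 \<in> {0, 1, 2, 3}" "k mod 4 \<in> {0, 1, 2, 3}" by auto
  then have "p mod 4 = 3 \<or> k mod 4 = 3" using prod by auto
  then show ?case
  proof
    assume "k mod 4 = 3"
    moreover have "k < n" using k p(1) \<open>n > 0\<close> by (auto dest: prime_gt_1_nat)
    ultimately show ?thesis using less.IH[of k] k by auto
  qed (use p in auto)
qed

text \<open>Integers congruent to 3 modulo 4 are as frequent among those coprime to a given $d$ as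
  integers congruent to 1, while each of them has a prime factor congruent to 3.\<close>

lemma sieve_3_mod_4:
  "\<exists>D>0. \<forall>N. real N \<le> (\<Sum>p\<in>primes_3_mod_4 (D * N) - {..y}. real N / real p + 1)"
proof -
  \<comment> \<open>Coprimality to \<open>D'\<close> removes the prime factors up to
    \<open>y\<close> that are 3 modulo 4. The factor 4 in \<open>D\<close> makes the residue modulo
    4 periodic as well.\<close>
  define D' where "D' = \<Prod>(primes_3_mod_4 y)"
  define D where "D = 4 * D'"
  have D'0: "D' > 0" unfolding D'_def by (intro prod_pos) (auto simp: primes_3_mod_4_def prime_gt_0_nat)
  then have D0: "D > 0" by (simp add: D_def)
  define P where "P = (\<lambda>r n. n mod 4 = r \<and> coprime n D')"
  define h where "h = card {n. n < D \<and> P 1 n}"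
  have per: "P r (n + D) = P r n" for r n
  proof -
    have "gcd D' (4 * D' + n) = gcd D' n" by (rule gcd_add_mult)
    then have "coprime (n + D) D' \<longleftrightarrow> coprime n D'"
      by (simp only: D_def coprime_iff_gcd_eq_1 gcd.commute[of _ D'] add.commute[of n])
    moreover have "(n + D) mod 4 = n mod 4" by (simp add: D_def)
    ultimately show ?thesis by (simp add: P_def)
  qed
  \<comment> \<open>The reflection n -> D - n exchanges the classes 1 and 3 modulo 4 and preserves
    coprimality to \<open>D'\<close>, so both classes have the same count \<open>h\<close> in one
    period.\<close>
  have refl: "P (4 - r) (D - n)" if "P r n" "n < D" "r \<in> {1, 3}" for r n
  proof -
    have "coprime (D - n) D'"
    proof (rule coprimeI)
      fix c assume c: "c dvd D - n" "c dvd D'"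
      then have "c dvd D" by (simp add: D_def)
      then have "c dvd D - (D - n)" using c(1) by (rule dvd_diff_nat)
      then have "c dvd n" using that by simp
      then show "is_unit c" using c(2) that(1) unfolding P_def by (meson coprime_common_divisor)
    qed
    moreover have "(4 * d - n) mod 4 = 4 - r" if "n < 4 * d" "n mod 4 = r" "r = 1 \<or> r = 3" for d
    proof -
      define k where "k = n div 4"
      have n: "n = 4 * k + r" using that(2) unfolding k_def by presburger
      then have "k < d" using that(1) by simp
      then obtain e where "d = Suc (k + e)" using less_imp_Suc_add by blast
      then have "4 * d - n = 4 * e + (4 - r)" using n that(3) by auto
      then show ?thesis using that(3) by auto
    qed
    then have "(D - n) mod 4 = 4 - r" using that unfolding P_def D_def by blast
    ultimately show ?thesis by (simp add: P_def)
  qed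
  have h3: "card {n. n < D \<and> P 3 n} = h"
    unfolding h_def
  proof (rule bij_betw_same_card[of "\<lambda>n. D - n"], rule bij_betwI[where g = "\<lambda>n. D - n"])
    show "(\<lambda>n. D - n) \<in> {n. n < D \<and> P 3 n} \<rightarrow> {n. n < D \<and> P 1 n}"
      using refl[of 3] D0 by (auto simp: P_def intro!: gr0I)
    show "(\<lambda>n. D - n) \<in> {n. n < D \<and> P 1 n} \<rightarrow> {n. n < D \<and> P 3 n}"
      using refl[of 1] D0 by (auto simp: P_def intro!: gr0I)
  qed auto
  \<comment> \<open>The integer 1 witnesses \<open>h > 0\<close>, which allows \<open>h\<close> to
    be cancelled at the end.\<close>
  have "P 1 1" by (simp add: P_def)
  then have "1 \<in> {n. n < D \<and> P 1 n}" using D'0 by (simp add: D_def)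
  then have h0: "h > 0" unfolding h_def by (metis (no_types, lifting) card_gt_0_iff empty_iff finite_nat_set_iff_bounded mem_Collect_eq)
  have main: "real N \<le> (\<Sum>p\<in>primes_3_mod_4 (D * N) - {..y}. real N / real p + 1)" for N
  proof -
    define Q where "Q = primes_3_mod_4 (D * N) - {..y}"
    have finQ: "finite Q" by (simp add: Q_def)
    \<comment> \<open>Writing n = p * k with a prime p that is 3 modulo 4, coprimality to
      \<open>D'\<close> forces p > y, and k falls into the class 1 modulo 4, whose count per period
      is again \<open>h\<close>.\<close>
    have sub: "{n. n < D * N \<and> P 3 n} \<subseteq> (\<Union>p\<in>Q. (\<lambda>k. p * k) ` {k. k \<le> D * N div p \<and> P 1 k})"
    proof
      fix n assume "n \<in> {n. n < D * N \<and> P 3 n}"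
      then have n: "n < D * N" "n mod 4 = 3" "coprime n D'" by (auto simp: P_def)
      obtain p where p: "prime p" "p mod 4 = 3" "p dvd n" using prime_factor_3_mod_4[OF n(2)] by blast
      then obtain k where k: "n = p * k" by auto
      have "p \<le> n" using n(2) p(3) by (intro dvd_imp_le) (auto intro: gr0I)
      have "\<not> p \<le> y"
      proof
        assume "p \<le> y"
        then have "p dvd D'" unfolding D'_def using p
          by (intro dvd_prodI) (auto simp: primes_3_mod_4_def)
        then show False using n(3) p by (meson coprime_common_divisor not_prime_unit)
      qed
      then have "p \<in> Q" using p \<open>p \<le> n\<close> n(1) by (auto simp: Q_def primes_3_mod_4_def)
      moreover have "k \<le> D * N div p"
        using n(1) k prime_gt_0_nat[OF p(1)] by (simp add: less_eq_div_iff_mult_less_eq mult.commute)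
      moreover have "k mod 4 = 1"
      proof -
        have "((p mod 4) * (k mod 4)) mod 4 = 3" using n(2) k by (simp add: mod_mult_eq)
        moreover have "k mod 4 \<in> {0, 1, 2, 3}" by auto
        ultimately show ?thesis using p(2) by auto
      qed
      moreover have "coprime k D'" using n(3) k by simp
      ultimately show "n \<in> (\<Union>p\<in>Q. (\<lambda>k. p * k) ` {k. k \<le> D * N div p \<and> P 1 k})"
        using k by (auto simp: P_def)
    qed
    have "N * h = card {n. n < D * N \<and> P 3 n}"
      using card_periodic[of "P 3" D N] per h3 by simp
    also have "\<dots> \<le> card (\<Union>p\<in>Q. (\<lambda>k. p * k) ` {k. k \<le> D * N div p \<and> P 1 k})"
      using finQ by (intro card_mono[OF _ sub]) auto
    also have "\<dots> \<le> (\<Sum>p\<in>Q. card ((\<lambda>k. p * k) ` {k. k \<le> D * N div p \<and> P 1 k}))"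
      by (rule card_UN_le[OF finQ])
    also have "\<dots> \<le> (\<Sum>p\<in>Q. (D * N div p div D + 1) * h)"
    proof (rule sum_mono)
      fix p
      have "card ((\<lambda>k. p * k) ` {k. k \<le> D * N div p \<and> P 1 k}) \<le> card {k. k \<le> D * N div p \<and> P 1 k}"
        by (rule card_image_le) auto
      also have "\<dots> \<le> (D * N div p div D + 1) * h"
        unfolding h_def by (intro card_periodic_le per D0)
      finally show "card ((\<lambda>k. p * k) ` {k. k \<le> D * N div p \<and> P 1 k}) \<le> (D * N div p div D + 1) * h" .
    qed
    also have "\<dots> = (\<Sum>p\<in>Q. N div p + 1) * h"
      using D0 by (simp add: sum_distrib_right div_mult2_eq[symmetric] mult.commute[of _ D])
    finally have "N \<le> (\<Sum>p\<in>Q. N div p + 1)" using h0 by simp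
    then have "real N \<le> real (\<Sum>p\<in>Q. N div p + 1)" by (simp only: of_nat_le_iff)
    also have "\<dots> = (\<Sum>p\<in>Q. real (N div p) + 1)" by (simp add: add.commute)
    also have "\<dots> \<le> (\<Sum>p\<in>Q. real N / real p + 1)"
      by (intro sum_mono add_right_mono of_nat_div_le_of_nat)
    finally show ?thesis by (simp add: Q_def)
  qed
  show ?thesis using D0 main by blast
qed

text \<open>Under the sparsity hypothesis the dyadic block from 2^J to 2^(J+1) contributes at most
  2/(J+2)^2, which is below 2/(J+1) - 2/(J+2); the sum over the blocks telescopes.\<close>

lemma sum_inverse_primes_3_mod_4_le:
  assumes "\<And>i. i \<ge> j \<Longrightarrow> real (card (primes_3_mod_4 (2 ^ i))) * real (i + 1) ^ 2 \<le> 2 ^ i" "j \<le> J"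
  shows "(\<Sum>p\<in>primes_3_mod_4 (2 ^ J) - {..2 ^ j}. 1 / real p) \<le> 2 / real (j + 1) - 2 / real (J + 1)"
  using assms(2)
proof (induction J rule: dec_induct)
  case base
  have "primes_3_mod_4 (2 ^ j) - {..2 ^ j} = {}" by (auto simp: primes_3_mod_4_def)
  then show ?case by (simp only: sum.empty)
next
  case (step J)
  let ?S = "\<lambda>J. primes_3_mod_4 (2 ^ J)"
  have "primes_3_mod_4 c - {..a} = (primes_3_mod_4 b - {..a}) \<union> (primes_3_mod_4 c - {..b})"
    if "a \<le> b" "b \<le> c" for a b c :: nat
    using that by (auto simp: primes_3_mod_4_def)
  from this[of "2^j" "2^J" "2^Suc J"]
  have split: "?S (Suc J) - {..2^j} = (?S J - {..2^j}) \<union> (?S (Suc J) - {..2 ^ J})"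
    using step.hyps by simp
  have "(\<Sum>p\<in>?S (Suc J) - {..2^j}. 1 / real p) =
      (\<Sum>p\<in>?S J - {..2^j}. 1 / real p) + (\<Sum>p\<in>?S (Suc J) - {..2 ^ J}. 1 / real p)"
    unfolding split by (rule sum.union_disjoint) (auto simp: primes_3_mod_4_def)
  moreover have "(\<Sum>p\<in>?S (Suc J) - {..2 ^ J}. 1 / real p) \<le> 2 / real (J + 1) - 2 / real (Suc J + 1)"
  proof -
    have "(\<Sum>p\<in>?S (Suc J) - {..2 ^ J}. 1 / real p) \<le> (\<Sum>p\<in>?S (Suc J) - {..2 ^ J}. 1 / 2 ^ J)"
    proof (rule sum_mono)
      fix p assume "p \<in> ?S (Suc J) - {..2 ^ J}"
      then have "real (2 ^ J) \<le> real p" by (simp only: of_nat_le_iff) auto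
      then show "1 / real p \<le> 1 / 2 ^ J" by (simp add: frac_le)
    qed
    also have "\<dots> = real (card (?S (Suc J) - {..2 ^ J})) / 2 ^ J" by simp
    also have "\<dots> \<le> real (card (?S (Suc J))) / 2 ^ J"
      by (intro divide_right_mono of_nat_mono card_mono) auto
    also have "\<dots> \<le> 2 / real (J + 2) ^ 2"
      using assms(1)[of "Suc J"] step.hyps by (simp add: field_simps)
    also have "\<dots> \<le> 2 / real (J + 1) - 2 / real (Suc J + 1)"
      by (simp add: divide_simps power2_eq_square)
    finally show ?thesis .
  qed
  ultimately show ?case using step.IH by linarith
qed

text \<open>If the primes were sparse from \<open>i0\<close> on, their reciprocals beyond 2^j would
  sum to at most 1/2. The sieve inequality would then give at least 2^i / (4 D) of them up to 2^i, a
  positive proportion, which contradicts sparsity for large i.\<close>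

lemma primes_3_mod_4_dense:
  "\<exists>i\<ge>i0. real (card (primes_3_mod_4 (2 ^ i))) * real (i + 1) ^ 2 > 2 ^ i"
proof (rule ccontr)
  assume "\<not> ?thesis"
  then have sparse: "\<And>i. i \<ge> i0 \<Longrightarrow> real (card (primes_3_mod_4 (2 ^ i))) * real (i + 1) ^ 2 \<le> 2 ^ i"
    by force
  \<comment> \<open>The shift by 3 makes \<open>2 / real (j + 1)\<close> at most 1/2.\<close>
  define j where "j = i0 + 3"
  obtain D where D: "D > 0"
    "\<And>N. real N \<le> (\<Sum>p\<in>primes_3_mod_4 (D * N) - {..2 ^ j}. real N / real p + 1)"
    using sieve_3_mod_4[of "2 ^ j"] by blast
  have bound: "real (i + 1) ^ 2 \<le> 4 * real D" if i: "i \<ge> j" "D \<le> 2 ^ i" for i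
  proof -
    define N where "N = 2 ^ i div D"
    define Q where "Q = primes_3_mod_4 (2 ^ i) - {..2 ^ j}"
    have finQ: "finite Q" by (simp add: Q_def)
    have DN: "D * N \<le> 2 ^ i" unfolding N_def by simp
    have "2 ^ i < D * N + D" unfolding N_def using D(1) by (metis dividend_less_times_div mult_Suc_right add.commute)
    moreover have "N \<ge> 1" unfolding N_def using i(2) D(1) by (simp add: Suc_leI div_greater_zero_iff)
    then have "D \<le> D * N" by simp
    ultimately have "2 ^ i \<le> 2 * D * N" by linarith
    then have "real (2 ^ i) \<le> real (2 * D * N)" by (simp only: of_nat_le_iff)
    then have N_ge: "2 ^ i \<le> 2 * real D * real N" by simp
    have "real N \<le> (\<Sum>p\<in>primes_3_mod_4 (D * N) - {..2 ^ j}. real N / real p + 1)" by (rule D(2))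
    also have "\<dots> \<le> (\<Sum>p\<in>Q. real N / real p + 1)"
      using DN finQ by (intro sum_mono2) (auto simp: Q_def primes_3_mod_4_def)
    also have "\<dots> = real N * (\<Sum>p\<in>Q. 1 / real p) + real (card Q)"
      by (simp add: sum.distrib sum_distrib_left)
    also have "(\<Sum>p\<in>Q. 1 / real p) \<le> 2 / real (j + 1) - 2 / real (i + 1)"
      unfolding Q_def by (rule sum_inverse_primes_3_mod_4_le[OF sparse i(1)]) (simp add: j_def)
    also have "\<dots> \<le> 2 / real (j + 1)" by simp
    also have "\<dots> \<le> 1 / 2" by (simp add: j_def)
    also have "card Q \<le> card (primes_3_mod_4 (2 ^ i))" by (rule card_mono) (auto simp: Q_def)
    finally have "real N \<le> 2 * real (card (primes_3_mod_4 (2 ^ i)))" by (simp add: mult_left_mono)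
    then have "2 ^ i \<le> 4 * real D * real (card (primes_3_mod_4 (2 ^ i)))"
      using N_ge mult_left_mono[of "real N" _ "2 * real D"] by fastforce
    then have "2 ^ i * real (i + 1) ^ 2 \<le> 4 * real D * (real (card (primes_3_mod_4 (2 ^ i))) * real (i + 1) ^ 2)"
      by (metis mult.assoc mult_right_mono zero_le_power2)
    also have "\<dots> \<le> 4 * real D * 2 ^ i"
      using sparse[of i] i by (intro mult_left_mono) (auto simp: j_def)
    finally show ?thesis by simp
  qed
  \<comment> \<open>Large enough that i + 1 exceeds 4 D and that D is at most 2^i.\<close>
  define i where "i = j + 4 * D"
  have "D \<le> i" by (simp add: i_def)
  also have "i \<le> 2 ^ i" by (rule less_imp_le[OF less_exp])
  finally have "D \<le> 2 ^ i" .
  then have "real (i + 1) ^ 2 \<le> 4 * real D" by (intro bound) (simp_all add: i_def)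
  also have "4 * real D < real (i + 1)" by (simp add: i_def)
  also have "real (i + 1) \<le> real (i + 1) ^ 2" by (rule self_le_power) auto
  finally show False by simp
qed

subsection \<open>Values of $x^f(x-1)$ modulo a prime\<close>

text \<open>Lagrange's bound for the roots of a polynomial modulo a prime, on integer
  representatives. The coefficient hypothesis says that \<open>P\<close> is nonzero modulo
  \<open>p\<close>, and it passes to the quotient when a root is split off.\<close>

lemma card_poly_roots_mod_prime_le:
  fixes P :: "int poly"
  assumes p: "prime p"
  shows "degree P \<le> d \<Longrightarrow> \<exists>i. \<not> p dvd coeff P i \<Longrightarrow> card {x\<in>{0..<p}. p dvd poly P x} \<le> d"
proof (induction d arbitrary: P)
  case 0
  then obtain c where "P = [:c:]" by (auto elim: degree_eq_zeroE)
  then have "p dvd coeff P i" if "p dvd c" for i using that by (cases i) simp_all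
  then have "\<not> p dvd c" using 0 by blast
  then show ?case using \<open>P = [:c:]\<close> by simp
next
  case (Suc d)
  show ?case
  proof (cases "\<exists>r\<in>{0..<p}. p dvd poly P r")
    case False
    then have "{x\<in>{0..<p}. p dvd poly P x} = {}" by auto
    then show ?thesis by (metis card.empty zero_le)
  next
    case True
    then obtain r where r: "r \<in> {0..<p}" "p dvd poly P r" by auto
    define Q where "Q = synthetic_div P r"
    have dec: "P = [:-r, 1:] * Q + [:poly P r:]"
      unfolding Q_def by (rule synthetic_div_correct'[symmetric])
    have ev: "poly P x = (x - r) * poly Q x + poly P r" for x
      by (subst dec) (simp add: algebra_simps)
    have "\<exists>i. \<not> p dvd coeff Q i"
    proof (rule ccontr)
      assume "\<not> ?thesis"
      then have all: "p dvd coeff Q i" for i by auto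
      have "p dvd coeff P i" for i
        by (subst dec) (use all r(2) in \<open>auto simp: coeff_pCons split: nat.splits\<close>)
      then show False using Suc.prems by auto
    qed
    moreover have "degree Q \<le> d" using Suc.prems by (simp add: Q_def degree_synthetic_div)
    ultimately have IH: "card {x\<in>{0..<p}. p dvd poly Q x} \<le> d" by (rule Suc.IH[rotated])
    have sub: "{x\<in>{0..<p}. p dvd poly P x} \<subseteq> insert r {x\<in>{0..<p}. p dvd poly Q x}"
    proof
      fix x assume x: "x \<in> {x\<in>{0..<p}. p dvd poly P x}"
      then have "p dvd (x - r) * poly Q x"
        using r(2) ev[of x] by (metis (mono_tags, lifting) add_diff_cancel_right' dvd_diff mem_Collect_eq)
      then have "p dvd x - r \<or> p dvd poly Q x" using p by (simp add: prime_dvd_mult_iff)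
      moreover have "x = r" if "p dvd x - r"
        using that x r(1) by (auto dest!: mod_eq_dvd_iff[THEN iffD2])
      ultimately show "x \<in> insert r {x\<in>{0..<p}. p dvd poly Q x}" using x by auto
    qed
    define S where "S = {x\<in>{0..<p}. p dvd poly Q x}"
    have finS: "finite S" by (rule finite_subset[of _ "{0..<p}"]) (auto simp: S_def)
    have "card {x\<in>{0..<p}. p dvd poly P x} \<le> card (insert r S)"
      using finS sub by (intro card_mono) (simp_all add: S_def)
    also have "\<dots> \<le> Suc (card S)" using finS by (simp add: card_insert_if)
    also have "\<dots> \<le> Suc d" using IH by (simp add: S_def)
    finally show ?thesis .
  qed
qed

text \<open>Every fibre through a colliding point contains at least two colliding points, so these
  points take at most half as many values as there are of them. Everything is doubled to avoid
  fractions.\<close>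

lemma card_image_collisions:
  assumes "finite A"
  shows "2 * card (f ` A) + card {x\<in>A. \<exists>y\<in>A. y \<noteq> x \<and> f y = f x} \<le> 2 * card A"
proof -
  define C where "C = {x\<in>A. \<exists>y\<in>A. y \<noteq> x \<and> f y = f x}"
  have CA: "C \<subseteq> A" by (auto simp: C_def)
  have finC: "finite C" using assms CA finite_subset by blast
  have "2 * card (f ` C) = (\<Sum>v\<in>f ` C. 2)" by simp
  also have "\<dots> \<le> (\<Sum>v\<in>f ` C. card {x\<in>C. f x = v})"
  proof (rule sum_mono)
    fix v assume "v \<in> f ` C"
    then obtain x y where xy: "x \<in> C" "f x = v" "y \<in> A" "y \<noteq> x" "f y = v" by (auto simp: C_def)
    then have "y \<in> C" using CA by (auto simp: C_def)
    with xy have "{x, y} \<subseteq> {x\<in>C. f x = v}" by auto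
    then have "card {x, y} \<le> card {x\<in>C. f x = v}" by (rule card_mono[rotated]) (use finC in auto)
    then show "2 \<le> card {x\<in>C. f x = v}" using xy by simp
  qed
  also have "\<dots> = card C"
    using sum_fun_comp[of C "f ` C" f "\<lambda>_. 1::nat"] finC by simp
  finally have 1: "2 * card (f ` C) \<le> card C" .
  have "f ` A = f ` (A - C) \<union> f ` C" using CA by auto
  then have "card (f ` A) \<le> card (f ` (A - C)) + card (f ` C)" by (metis card_Un_le)
  also have "card (f ` (A - C)) \<le> card A - card C"
    using assms CA by (metis card_image_le card_Diff_subset finC finite_Diff)
  finally have "2 * card (f ` A) \<le> 2 * (card A - card C) + card C" using 1 by linarith
  moreover have "card C \<le> card A" using assms CA card_mono by blast
  ultimately show ?thesis unfolding C_def[symmetric] by linarith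
qed

lemma card_power_eq_one_mod_prime_le:
  fixes q :: int
  assumes "prime q" "f > 0"
  shows "card {t\<in>{0..<q}. q dvd t ^ f - 1} \<le> f"
proof -
  let ?P = "monom 1 f - 1 :: int poly"
  have "\<not> q dvd coeff ?P f" using assms by (auto simp: not_prime_unit)
  moreover have "degree ?P \<le> f" by (intro degree_diff_le) (simp_all add: degree_monom_le)
  ultimately have "card {t\<in>{0..<q}. q dvd poly ?P t} \<le> f"
    using card_poly_roots_mod_prime_le[OF assms(1), of ?P f] by blast
  then show ?thesis by (simp add: poly_monom)
qed

text \<open>The collisions $g(x) = g(tx)$ of $g(x) = x^f(x-1)$ are parametrised by the ratio $t$
  through $x = (1 - t^f)/(1 - t^{f+1})$.\<close>

lemma card_image_power_mult_pred_mod_prime: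
  fixes q :: int and f L :: nat
  assumes q: "prime q" and f: "0 < f" "f < L" and qL: "4 * int L \<le> q"
  shows "4 * int L * int (card ((\<lambda>x. x ^ f * (x - 1) mod q) ` {0..<q})) \<le> (4 * int L - 1) * q"
proof -
  define g where "g = (\<lambda>x. x ^ f * (x - 1) mod q)"
  define A where "A = {0..<q}"
  define C where "C = {x\<in>A. \<exists>y\<in>A. y \<noteq> x \<and> g y = g x}"
  \<comment> \<open>The excluded ratios are those for which x would be 0 or undefined, or for which
    tx would equal x. \<open>R x\<close> collects the ratios that lead to the same x.\<close>
  define T where "T = {t\<in>A. \<not> q dvd t \<and> \<not> q dvd t ^ f - 1 \<and> \<not> q dvd t ^ (f + 1) - 1}"
  define R where "R = (\<lambda>x. {t\<in>A. q dvd x * (1 - t ^ (f + 1)) - (1 - t ^ f)})"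
  have finA: "finite A" and cardA: "int (card A) = q"
    using prime_gt_1_int[OF q] by (simp_all add: A_def)
  have R: "card (R x) \<le> f + 1" for x
  proof -
    let ?P = "[:x - 1:] + monom 1 f - monom x (f + 1) :: int poly"
    \<comment> \<open>This coefficient keeps the polynomial nonzero modulo \<open>q\<close> even
      when \<open>q\<close> divides \<open>x\<close>.\<close>
    have "coeff ?P f = 1" using f by (auto simp: coeff_pCons split: nat.splits)
    then have "\<not> q dvd coeff ?P f" using q by (metis not_prime_unit)
    moreover have "degree ?P \<le> f + 1"
      by (intro degree_diff_le degree_add_le) (auto intro: order_trans[OF degree_monom_le])
    ultimately have "card {t\<in>{0..<q}. q dvd poly ?P t} \<le> f + 1"
      using card_poly_roots_mod_prime_le[OF q, of ?P "f + 1"] by blast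
    moreover have "poly ?P t = x * (1 - t ^ (f + 1)) - (1 - t ^ f)" for t
      by (simp add: poly_monom algebra_simps)
    ultimately show ?thesis by (simp only: R_def A_def)
  qed
  have sub: "T \<subseteq> (\<Union>x\<in>C. R x)"
  proof
    fix t assume t: "t \<in> T"
    have "\<not> q dvd 1 - t ^ (f + 1)" using t unfolding T_def by (simp add: dvd_diff_commute)
    then have "coprime (1 - t ^ (f + 1)) q" using prime_imp_coprime[OF q] coprime_commute by blast
    then obtain u where u: "[(1 - t ^ (f + 1)) * u = 1] (mod q)" using cong_solve_coprime_int by blast
    \<comment> \<open>This is (1 - t^f)/(1 - t^(f+1)), with \<open>u\<close> the inverse of the
      denominator. It collides with tx, so it lies in \<open>C\<close>.\<close>
    define x where "x = (1 - t ^ f) * u mod q"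
    have xA: "x \<in> A" using prime_gt_0_int[OF q] by (simp add: x_def A_def)
    have "[x = (1 - t ^ f) * u] (mod q)" by (simp add: x_def)
    then have "[x * (1 - t ^ (f + 1)) = (1 - t ^ f) * u * (1 - t ^ (f + 1))] (mod q)"
      by (rule cong_scalar_right)
    also have "(1 - t ^ f) * u * (1 - t ^ (f + 1)) = (1 - t ^ f) * ((1 - t ^ (f + 1)) * u)"
      by (simp add: algebra_simps)
    also have "[(1 - t ^ f) * ((1 - t ^ (f + 1)) * u) = (1 - t ^ f) * 1] (mod q)"
      using u by (rule cong_scalar_left)
    finally have xt: "q dvd x * (1 - t ^ (f + 1)) - (1 - t ^ f)"
      by (simp add: cong_iff_dvd_diff)
    define y where "y = t * x mod q"
    have yA: "y \<in> A" using prime_gt_0_int[OF q] by (simp add: y_def A_def)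
    have "\<not> q dvd x"
    proof
      assume "q dvd x"
      then have "q dvd x * (1 - t ^ (f + 1))" by simp
      then have "q dvd 1 - t ^ f" using xt dvd_diff_right_iff by blast
      then show False using t by (simp add: T_def dvd_diff_commute)
    qed
    moreover have "\<not> q dvd t - 1"
    proof
      assume "q dvd t - 1"
      moreover have "t - 1 dvd t ^ f - 1" by (subst power_diff_1_eq) simp
      ultimately have "q dvd t ^ f - 1" by (rule dvd_trans)
      then show False using t by (simp add: T_def)
    qed
    ultimately have "\<not> q dvd (t - 1) * x" using q by (simp add: prime_dvd_mult_iff)
    then have nd: "\<not> q dvd t * x - x" by (simp add: algebra_simps)
    have "y \<noteq> x"
    proof
      assume "y = x"
      then have "[t * x = x] (mod q)" using xA by (simp add: y_def cong_def A_def)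
      then show False using nd by (simp add: cong_iff_dvd_diff)
    qed
    moreover have "g y = g x"
    proof -
      have "[y = t * x] (mod q)" by (simp add: y_def)
      then have "[y ^ f * (y - 1) = (t * x) ^ f * (t * x - 1)] (mod q)"
        by (intro cong_mult cong_pow cong_diff cong_refl)
      moreover have "(t * x) ^ f * (t * x - 1) - x ^ f * (x - 1) =
          x ^ f * - (x * (1 - t ^ (f + 1)) - (1 - t ^ f))"
        by (simp add: algebra_simps power_mult_distrib)
      then have "[(t * x) ^ f * (t * x - 1) = x ^ f * (x - 1)] (mod q)"
        unfolding cong_iff_dvd_diff using xt by (simp only: dvd_minus_iff dvd_mult)
      ultimately show ?thesis unfolding g_def cong_def by (rule trans)
    qed
    ultimately have "x \<in> C" using xA yA by (auto simp: C_def)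
    then show "t \<in> (\<Union>x\<in>C. R x)" using xt t by (auto simp: R_def T_def)
  qed
  have finC: "finite C" using finA by (simp add: C_def)
  have finR: "finite (R x)" for x using finA by (simp add: R_def)
  have "card T \<le> card (\<Union>x\<in>C. R x)" using finC finR by (intro card_mono[OF _ sub]) auto
  also have "\<dots> \<le> (\<Sum>x\<in>C. card (R x))" by (rule card_UN_le[OF finC])
  also have "\<dots> \<le> (\<Sum>x\<in>C. f + 1)" by (intro sum_mono R)
  also have "\<dots> = card C * (f + 1)" by simp
  also have "\<dots> \<le> card C * L" using f by (intro mult_le_mono2) simp
  finally have T1: "card T \<le> card C * L" .
  have "A \<subseteq> T \<union> {0} \<union> {t\<in>A. q dvd t ^ f - 1} \<union> {t\<in>A. q dvd t ^ (f + 1) - 1}"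
    by (auto simp: T_def A_def dest: zdvd_imp_le)
  then have "card A \<le> card (T \<union> {0} \<union> {t\<in>A. q dvd t ^ f - 1} \<union> {t\<in>A. q dvd t ^ (f + 1) - 1})"
    using finA by (intro card_mono) (auto simp: T_def)
  also have "\<dots> \<le> card T + card {0::int} + card {t\<in>A. q dvd t ^ f - 1} + card {t\<in>A. q dvd t ^ (f + 1) - 1}"
    by (intro order_trans[OF card_Un_le] add_mono order_refl)
  also have "\<dots> \<le> card T + 1 + f + (f + 1)"
    unfolding A_def using f
    by (intro add_mono card_power_eq_one_mod_prime_le q) auto
  \<comment> \<open>Since 2L is at most half of \<open>card A\<close>, at least a proportion 1/(2L)
    of all points collide, and this costs a proportion 1/(4L) of the values.\<close>
  finally have "card A \<le> card C * L + 2 * L" using T1 f by linarith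
  moreover have "4 * L \<le> card A" using qL cardA by linarith
  moreover have "2 * L * card C = 2 * (card C * L)" by simp
  ultimately have "card A \<le> 2 * L * card C" by linarith
  moreover have "2 * card (g ` A) + card C \<le> 2 * card A"
    unfolding C_def by (rule card_image_collisions[OF finA])
  then have "2 * L * (2 * card (g ` A) + card C) \<le> 2 * L * (2 * card A)" by (rule mult_le_mono2)
  ultimately have "4 * L * card (g ` A) + card A \<le> 4 * L * card A"
    by (simp add: algebra_simps)
  then have "int (4 * L * card (g ` A) + card A) \<le> int (4 * L * card A)" by (simp only: of_nat_le_iff)
  then show ?thesis using cardA unfolding g_def A_def by (simp add: algebra_simps)
qed

text \<open>The set counted consists of the n for which 1 - 1/n is attained, with the denominator
  cleared. As n -> 1 - 1/n is injective, there are at most as many of them as values of x^f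
  (x-1).\<close>

lemma card_unattained_residues:
  fixes q f L :: nat
  assumes q: "prime q" and f: "0 < f" "f < L" and qL: "4 * L \<le> q"
  shows "real (card {n. n < q \<and> (\<exists>x::int. [int n * (x ^ f * (x - 1)) = int n - 1] (mod int q))})
    \<le> (1 - 1 / (4 * real L)) * real q"
proof -
  define Y where "Y = {n. n < q \<and> (\<exists>x::int. [int n * (x ^ f * (x - 1)) = int n - 1] (mod int q))}"
  define g where "g = (\<lambda>x::int. x ^ f * (x - 1) mod int q)"
  have "\<exists>c\<in>g ` {0..<int q}. [int n * c = int n - 1] (mod int q)" if n: "n \<in> Y" for n
  proof -
    obtain x where x: "[int n * (x ^ f * (x - 1)) = int n - 1] (mod int q)"
      using n unfolding Y_def by blast
    have "[x mod int q = x] (mod int q)" by simp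
    then have "[(x mod int q) ^ f * (x mod int q - 1) = x ^ f * (x - 1)] (mod int q)"
      by (intro cong_mult cong_pow cong_diff cong_refl)
    then have "g (x mod int q) = g x" by (simp only: g_def cong_def)
    then have "g x \<in> g ` {0..<int q}"
      using prime_gt_0_nat[OF q] by (metis atLeastLessThan_iff image_eqI of_nat_0_less_iff pos_mod_bound pos_mod_sign)
    moreover have "[int n * g x = int n - 1] (mod int q)"
      using x unfolding g_def cong_def by (metis mod_mult_right_eq)
    ultimately show ?thesis by blast
  qed
  then obtain h where h: "\<And>n. n \<in> Y \<Longrightarrow> h n \<in> g ` {0..<int q}"
      "\<And>n. n \<in> Y \<Longrightarrow> [int n * h n = int n - 1] (mod int q)" by metis
  have "inj_on h Y"
  proof (rule inj_onI)
    fix a b assume ab: "a \<in> Y" "b \<in> Y" "h a = h b"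
    have a: "int q dvd int a * h a - (int a - 1)" and b: "int q dvd int b * h a - (int b - 1)"
      using h(2)[OF ab(1)] h(2)[OF ab(2)] ab(3) by (simp_all add: cong_iff_dvd_diff)
    have "int q dvd (int a * h a - (int a - 1)) - (int b * h a - (int b - 1))"
      using a b by (rule dvd_diff)
    also have "\<dots> = (int a - int b) * (h a - 1)" by (simp add: algebra_simps)
    finally have "int q dvd int a - int b \<or> int q dvd h a - 1"
      using q by (simp add: prime_dvd_mult_iff)
    moreover have "\<not> int q dvd h a - 1"
    proof
      assume "int q dvd h a - 1"
      then have "int q dvd int a * (h a - 1)" by simp
      then have "int q dvd (int a * h a - (int a - 1)) - int a * (h a - 1)" using a by (rule dvd_diff[rotated])
      then have "int q dvd 1" by (simp add: algebra_simps)
      then show False using q by (metis not_prime_unit prime_nat_int_transfer)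
    qed
    ultimately have "[int a = int b] (mod int q)" by (simp add: cong_iff_dvd_diff)
    then show "a = b" using ab by (auto simp: Y_def cong_int_iff cong_def)
  qed
  then have "card Y \<le> card (g ` {0..<int q})"
    using h(1) by (intro card_inj_on_le) auto
  then have "4 * int L * int (card Y) \<le> 4 * int L * int (card (g ` {0..<int q}))"
    by (intro mult_left_mono) auto
  also have "\<dots> \<le> (4 * int L - 1) * int q"
    unfolding g_def using q f qL by (intro card_image_power_mult_pred_mod_prime) auto
  finally have "real_of_int (4 * int L * int (card Y)) \<le> real_of_int ((4 * int L - 1) * int q)"
    by (simp only: of_int_le_iff)
  then have "4 * real L * real (card Y) \<le> (4 * real L - 1) * real q" by simp
  then show ?thesis using f unfolding Y_def[symmetric] by (simp add: field_simps)
qed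

subsection \<open>Choice of the prime\<close>

text \<open>By the Chinese remainder theorem the residues modulo the primes in \<open>Q\<close>
  determine n within one period \<open>\<Prod>Q\<close>, so the number of solutions in a period is
  at most the product of the local counts.\<close>

lemma card_sieve_coprime_moduli_le:
  fixes R :: "nat \<Rightarrow> nat \<Rightarrow> bool"
  assumes fin: "finite Q" and prime: "\<And>q. q \<in> Q \<Longrightarrow> prime q"
    and R: "\<And>q n. q \<in> Q \<Longrightarrow> R q (n mod q) = R q n"
  shows "card {n. n \<le> X \<and> (\<forall>q\<in>Q. R q n)} \<le> (X div \<Prod>Q + 1) * (\<Prod>q\<in>Q. card {n. n < q \<and> R q n})"
proof -
  define P where "P = (\<lambda>n. \<forall>q\<in>Q. R q n)"
  have W0: "\<Prod>Q > 0" using prime by (intro prod_pos) (auto simp: prime_gt_0_nat)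
  have P: "P (n + \<Prod>Q) = P n" for n
  proof -
    have "(n + \<Prod>Q) mod q = n mod q" if "q \<in> Q" for q
    proof -
      have "q dvd \<Prod>Q" using dvd_prodI[OF fin that, of "\<lambda>q. q"] by simp
      then show ?thesis by auto
    qed
    then show ?thesis unfolding P_def by (metis R)
  qed
  define h where "h = (\<lambda>n. \<lambda>q\<in>Q. n mod q)"
  have "inj_on h {n. n < \<Prod>Q \<and> P n}"
  proof (rule inj_onI)
    fix a b assume ab: "a \<in> {n. n < \<Prod>Q \<and> P n}" "b \<in> {n. n < \<Prod>Q \<and> P n}" "h a = h b"
    have "[a = b] (mod q)" if "q \<in> Q" for q
      using fun_cong[OF ab(3), of q] that by (simp add: h_def cong_def)
    moreover have "coprime q r" if "q \<in> Q" "r \<in> Q" "q \<noteq> r" for q r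
      using that prime by (simp add: primes_coprime)
    ultimately have "[a = b] (mod \<Prod>Q)"
      using cong_cong_prod_coprime_nat[of Q a b "\<lambda>q. q"] by simp
    then show "a = b" using ab by (simp add: cong_def)
  qed
  moreover have "h ` {n. n < \<Prod>Q \<and> P n} \<subseteq> (\<Pi>\<^sub>E q\<in>Q. {n. n < q \<and> R q n})"
    using R prime by (auto simp: h_def P_def prime_gt_0_nat)
  ultimately have "card {n. n < \<Prod>Q \<and> P n} \<le> card (\<Pi>\<^sub>E q\<in>Q. {n. n < q \<and> R q n})"
    using fin by (intro card_inj_on_le[of h] finite_PiE) auto
  also have "\<dots> = (\<Prod>q\<in>Q. card {n. n < q \<and> R q n})" by (rule card_PiE[OF fin])
  finally have "(X div \<Prod>Q + 1) * card {n. n < \<Prod>Q \<and> P n} \<le>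
      (X div \<Prod>Q + 1) * (\<Prod>q\<in>Q. card {n. n < q \<and> R q n})" by (rule mult_le_mono2)
  moreover have "card {n. n \<le> X \<and> P n} \<le> (X div \<Prod>Q + 1) * card {n. n < \<Prod>Q \<and> P n}"
    using card_periodic_le[of P "\<Prod>Q" X] P W0 by blast
  ultimately show ?thesis by (simp add: P_def)
qed

text \<open>There are at least M + c primes up to 4^(M+c), and at most c of them are discarded for
  being at most c.\<close>

lemma exists_primes_between:
  "\<exists>Q. finite Q \<and> card Q = M \<and> (\<forall>q\<in>Q. prime q \<and> c < q \<and> q \<le> (4::nat) ^ (M + c))"
proof -
  let ?P = "{p::nat. prime p \<and> p \<le> 4 ^ (M + c)}"
  have "finite ?P" by (rule finite_subset[of _ "{..4 ^ (M + c)}"]) auto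
  moreover have "M + c \<le> card ?P" by (rule card_primes_le_four_pow)
  moreover have "card ?P - card {1..c} \<le> card (?P - {1..c})" by (rule diff_card_le_card_Diff) simp
  ultimately have "M \<le> card (?P - {1..c})" by simp
  then obtain Q where Q: "Q \<subseteq> ?P - {1..c}" "card Q = M" "finite Q"
    by (rule obtain_subset_with_card_n)
  have "prime q \<and> c < q \<and> q \<le> 4 ^ (M + c)" if "q \<in> Q" for q
  proof -
    have q: "prime q" "q \<le> 4 ^ (M + c)" "q \<notin> {1..c}" using Q(1) that by blast+
    with prime_gt_0_nat[OF q(1)] show ?thesis by simp
  qed
  with Q show ?thesis by blast
qed

text \<open>The exponent splits as 4L times 5L: the power 4L brings the base below 1/e, hence below
  1/2, and 2^5 = 32.\<close>

lemma one_minus_inverse_power_le: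
  assumes "L > 0"
  shows "(1 - 1 / (4 * real L)) ^ (20 * L\<^sup>2) \<le> (1 / 32) ^ L"
proof -
  have "(1 - 1 / (4 * real L)) ^ (4 * L) \<le> exp (- (1 / (4 * real L))) ^ (4 * L)"
    using assms exp_ge_add_one_self[of "- (1 / (4 * real L))"]
    by (intro power_mono) (auto simp: field_simps)
  also have "\<dots> = exp (- 1)" using assms by (simp flip: exp_of_nat_mult)
  also have "\<dots> \<le> 1 / 2" using exp_ge_add_one_self[of 1] by (simp add: exp_minus field_simps)
  finally have "((1 - 1 / (4 * real L)) ^ (4 * L)) ^ (5 * L) \<le> (1 / 2) ^ (5 * L)"
    using assms by (intro power_mono) (auto simp: field_simps)
  also have "\<dots> = ((1 / 2) ^ 5) ^ L" by (rule power_mult)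
  also have "(1 / 2 :: real) ^ 5 = 1 / 32" by (simp add: power_divide)
  finally show ?thesis by (simp add: power_mult[symmetric] power2_eq_square algebra_simps)
qed

text \<open>An integer is bad for \<open>f\<close> if 1 - 1/n is attained modulo every prime of
  \<open>Q\<close>. At most 2 * 2^i / 32^L integers are bad for a given \<open>f\<close>, and
  \<open>W\<close> is small compared with 2^i / 4^(L+1). By the density hypothesis, the bad integers
  for all \<open>f < L\<close> and the integers up to \<open>W\<close> cannot cover all the
  available primes.\<close>

lemma exists_prime_unattained:
  fixes L i :: nat
  assumes L: "L \<ge> 2" "1000 * L ^ 4 \<le> 2 ^ L" and i: "2 ^ L \<le> i" "i < 2 ^ Suc L"
    and dense: "real (card (primes_3_mod_4 (2 ^ i))) * real (i + 1) ^ 2 > 2 ^ i"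
  shows "\<exists>p W. prime p \<and> p mod 4 = 3 \<and> p \<le> 2 ^ i \<and> W < p \<and> 6 * L + 2 \<le> W \<and>
    (\<forall>f. 0 < f \<and> f < L \<longrightarrow> \<not> (\<exists>x::int. [int p * (x ^ f * (x - 1)) = int p - 1] (mod int W)))"
proof -
  define M where "M = 20 * L\<^sup>2"
  obtain Q :: "nat set" where Q: "finite Q" "card Q = M"
      "\<And>q. q \<in> Q \<Longrightarrow> prime q" "\<And>q. q \<in> Q \<Longrightarrow> 4 * L < q" "\<And>q. q \<in> Q \<Longrightarrow> q \<le> 4 ^ (M + 4 * L)"
    using exists_primes_between[of M "4 * L"] by blast
  define W where "W = \<Prod>Q"
  have W0: "W > 0" unfolding W_def using Q(3) by (intro prod_pos) (auto simp: prime_gt_0_nat)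
  \<comment> \<open>As W < p, this also bounds p from below; later it turns (p-1) | f+1 into 6L
    \<le> f.\<close>
  have W_ge: "6 * L + 2 \<le> W"
  proof -
    have "6 * L + 2 \<le> 20 * (L * L)" using L(1) mult_le_mono[OF L(1) order_refl, of L] by linarith
    also have "\<dots> \<le> M" by (simp add: M_def power2_eq_square)
    also have "\<dots> \<le> 2 ^ M" by (rule less_imp_le[OF less_exp])
    also have "\<dots> = (\<Prod>q\<in>Q. 2)" using Q(2) by simp
    also have "\<dots> \<le> W" unfolding W_def using Q(3) by (intro prod_mono) (auto simp: prime_ge_2_nat)
    finally show ?thesis .
  qed
  \<comment> \<open>The binary logarithm of \<open>W\<close> is of order L^4, which 1000 L^4 \<le>
    2^L \<le> i absorbs. The extra factor leaves room for multiplying \<open>W\<close> by (i+1)^2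
    \<le> 4^(L+1).\<close>
  have W_le: "2 * 4 ^ (L + 1) * W \<le> 2 ^ i"
  proof -
    have "W \<le> (\<Prod>q\<in>Q. 4 ^ (M + 4 * L))" unfolding W_def using Q(5) by (intro prod_mono) auto
    also have "\<dots> = 4 ^ ((M + 4 * L) * M)" using Q(2) by (simp add: power_mult)
    also have "\<dots> = 2 ^ (2 * ((M + 4 * L) * M))" by (simp add: power_mult)
    finally have "2 * 4 ^ (L + 1) * W \<le> 2 * 4 ^ (L + 1) * 2 ^ (2 * ((M + 4 * L) * M))"
      by (rule mult_le_mono2)
    also have "\<dots> = 2 ^ (1 + 2 * (L + 1) + 2 * ((M + 4 * L) * M))"
      by (simp only: power_add power_one_right) (simp add: power_mult)
    also have "\<dots> \<le> 2 ^ i"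
    proof (rule power_increasing)
      define X where "X = (M + 4 * L) * M"
      have "L \<le> L\<^sup>2" using L(1) by (simp add: self_le_power)
      then have "(M + 4 * L) * M \<le> (24 * L\<^sup>2) * (20 * L\<^sup>2)" unfolding M_def by (intro mult_le_mono) auto
      also have "\<dots> = 480 * L ^ 4" by (simp add: power2_eq_square power4_eq_xxxx)
      finally have "X \<le> 480 * L ^ 4" by (simp only: X_def)
      moreover have "L \<le> L ^ 4" using L(1) by (simp add: self_le_power)
      ultimately have "1 + 2 * (L + 1) + 2 * X \<le> 1000 * L ^ 4" using L(1) by (simp del: power_increasing_iff)
      also have "\<dots> \<le> i" using L(2) i(1) by (rule le_trans)
      finally have "1 + 2 * (L + 1) + 2 * X \<le> i" .
      then show "1 + 2 * (L + 1) + 2 * ((M + 4 * L) * M) \<le> i" by (simp only: X_def)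
    qed simp
    finally show ?thesis .
  qed
  define R where "R = (\<lambda>f q n. \<exists>x::int. [int n * (x ^ f * (x - 1)) = int n - 1] (mod int q))"
  have R_mod: "R f q (n mod q) = R f q n" for f q n
  proof -
    have eq: "[int (n mod q) = int n] (mod int q)" by (simp add: zmod_int)
    have "[int (n mod q) * (x ^ f * (x - 1)) = int (n mod q) - 1] (mod int q) \<longleftrightarrow>
          [int n * (x ^ f * (x - 1)) = int n - 1] (mod int q)" for x
      using cong_scalar_right[OF eq, of "x ^ f * (x - 1)"] cong_diff[OF eq cong_refl[of 1]]
      by (metis cong_sym cong_trans)
    then show ?thesis by (simp add: R_def)
  qed
  define B where "B = (\<lambda>f. {n. n \<le> 2 ^ i \<and> (\<forall>q\<in>Q. R f q n)})"
  have card_B: "real (card (B f)) \<le> 2 * 2 ^ i * (1 / 32) ^ L" if f: "0 < f" "f < L" for f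
  proof -
    have "card (B f) \<le> (2 ^ i div W + 1) * (\<Prod>q\<in>Q. card {n. n < q \<and> R f q n})"
      unfolding B_def W_def
      using card_sieve_coprime_moduli_le[of Q "R f" "2 ^ i"] Q(1,3) R_mod by blast
    then have "real (card (B f)) \<le> real ((2 ^ i div W + 1) * (\<Prod>q\<in>Q. card {n. n < q \<and> R f q n}))"
      by (simp only: of_nat_le_iff)
    also have "\<dots> = (real (2 ^ i div W) + 1) * (\<Prod>q\<in>Q. real (card {n. n < q \<and> R f q n}))"
      by (simp add: algebra_simps)
    also have "\<dots> \<le> (2 ^ i / real W + 1) * (\<Prod>q\<in>Q. (1 - 1 / (4 * real L)) * real q)"
    proof (intro mult_mono prod_mono conjI)
      show "real (2 ^ i div W) + 1 \<le> 2 ^ i / real W + 1"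
        using of_nat_div_le_of_nat[of "2 ^ i" W] by simp
      fix q assume "q \<in> Q"
      then show "real (card {n. n < q \<and> R f q n}) \<le> (1 - 1 / (4 * real L)) * real q"
        unfolding R_def using Q f by (intro card_unattained_residues) (auto simp: less_imp_le)
    qed (auto intro: prod_nonneg)
    also have "(\<Prod>q\<in>Q. (1 - 1 / (4 * real L)) * real q) = (1 - 1 / (4 * real L)) ^ M * real W"
      by (simp add: prod.distrib Q(2) W_def)
    also have "(2 ^ i / real W + 1) * ((1 - 1 / (4 * real L)) ^ M * real W) =
        (2 ^ i + real W) * (1 - 1 / (4 * real L)) ^ M"
      using W0 by (simp add: field_simps)
    also have "\<dots> \<le> (2 * 2 ^ i) * (1 / 32) ^ L"
    proof (rule mult_mono)
      have "W \<le> 2 * 4 ^ (L + 1) * W" by simp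
      then have "W \<le> 2 ^ i" using W_le by (rule le_trans)
      then have "real W \<le> real (2 ^ i)" by (simp only: of_nat_le_iff)
      then show "2 ^ i + real W \<le> 2 * 2 ^ i" by simp
      show "(1 - 1 / (4 * real L)) ^ M \<le> (1 / 32) ^ L"
        unfolding M_def using L by (intro one_minus_inverse_power_le) auto
      show "0 \<le> (1 - 1 / (4 * real L)) ^ M" using L by (intro zero_le_power) (auto simp: field_simps)
    qed simp
    finally show ?thesis .
  qed
  have "\<not> primes_3_mod_4 (2 ^ i) \<subseteq> {1..W} \<union> (\<Union>f\<in>{0<..<L}. B f)"
  proof
    assume sub: "primes_3_mod_4 (2 ^ i) \<subseteq> {1..W} \<union> (\<Union>f\<in>{0<..<L}. B f)"
    have finB: "finite (B f)" for f by (rule finite_subset[of _ "{..2 ^ i}"]) (auto simp: B_def)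
    have "card (primes_3_mod_4 (2 ^ i)) \<le> card ({1..W} \<union> (\<Union>f\<in>{0<..<L}. B f))"
      using finB by (intro card_mono[OF _ sub]) auto
    also have "\<dots> \<le> card {1..W} + card (\<Union>f\<in>{0<..<L}. B f)" by (rule card_Un_le)
    also have "\<dots> \<le> W + (\<Sum>f\<in>{0<..<L}. card (B f))"
      by (intro add_mono card_UN_le) auto
    finally have "real (card (primes_3_mod_4 (2 ^ i))) \<le> real (W + (\<Sum>f\<in>{0<..<L}. card (B f)))"
      by (simp only: of_nat_le_iff)
    also have "\<dots> = real W + (\<Sum>f\<in>{0<..<L}. real (card (B f)))" by simp
    also have "\<dots> \<le> real W + (\<Sum>f\<in>{0<..<L}. 2 * 2 ^ i * (1 / 32) ^ L)"
      using card_B by (intro add_left_mono sum_mono) auto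
    also have "\<dots> \<le> real W + real L * (2 * 2 ^ i * (1 / 32) ^ L)"
      by (simp add: mult_right_mono)
    finally have "real (card (primes_3_mod_4 (2 ^ i))) * real (i + 1) ^ 2 \<le>
        (real W + real L * (2 * 2 ^ i * (1 / 32) ^ L)) * real (4 ^ (L + 1))"
    proof (rule mult_mono)
      have "(i + 1) ^ 2 \<le> (2 ^ Suc L) ^ 2" using i(2) by (intro power_mono) auto
      also have "\<dots> = 4 ^ (L + 1)" by (simp add: power_mult[symmetric] mult.commute[of _ 2]) (simp add: power_mult)
      finally have "real ((i + 1) ^ 2) \<le> real (4 ^ (L + 1))" by (simp only: of_nat_le_iff)
      then show "real (i + 1) ^ 2 \<le> real (4 ^ (L + 1))" by simp
    qed auto
    also have "\<dots> = real W * 4 ^ (L + 1) + 2 ^ i * (8 * real L * (4 ^ L * (1 / 32) ^ L))"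
      by (simp add: algebra_simps)
    also have "\<dots> = real W * 4 ^ (L + 1) + 2 ^ i * (8 * real L * (4 / 32) ^ L)"
      by (simp only: power_mult_distrib[symmetric]) simp
    \<comment> \<open>The integers up to \<open>W\<close> and the bad integers each account for at
      most half of 2^i; the strict inequality in \<open>dense\<close> is then violated.\<close>
    also have "\<dots> \<le> 2 ^ i / 2 + 2 ^ i * (1 / 2)"
    proof (intro add_mono mult_left_mono)
      have "real (2 * 4 ^ (L + 1) * W) \<le> real (2 ^ i)" using W_le by (simp only: of_nat_le_iff)
      then show "real W * 4 ^ (L + 1) \<le> 2 ^ i / 2" by (simp add: algebra_simps)
      have "16 * L \<le> 1000 * L ^ 4" using self_le_power[of L 4] L(1) by simp
      also have "\<dots> \<le> 2 ^ L" by (rule L)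
      also have "\<dots> \<le> 8 ^ L" by (rule power_mono) auto
      finally have "real (16 * L) \<le> real (8 ^ L)" by (simp only: of_nat_le_iff)
      then show "8 * real L * (4 / 32) ^ L \<le> 1 / 2" by (simp add: power_divide divide_simps)
    qed simp
    finally show False using dense by simp
  qed
  then obtain p where p0: "p \<in> primes_3_mod_4 (2 ^ i)" "p \<notin> {1..W} \<union> (\<Union>f\<in>{0<..<L}. B f)"
    by blast
  then have p: "p \<in> primes_3_mod_4 (2 ^ i)" "p \<notin> {1..W}" "\<And>f. 0 < f \<Longrightarrow> f < L \<Longrightarrow> p \<notin> B f"
    by auto
  have "\<not> (\<exists>x::int. [int p * (x ^ f * (x - 1)) = int p - 1] (mod int W))" if "0 < f" "f < L" for f
  proof
    assume "\<exists>x::int. [int p * (x ^ f * (x - 1)) = int p - 1] (mod int W)"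
    then obtain x :: int where x: "[int p * (x ^ f * (x - 1)) = int p - 1] (mod int W)" by blast
    have "R f q p" if "q \<in> Q" for q
    proof -
      have "q dvd W" unfolding W_def using dvd_prodI[OF Q(1) that, of "\<lambda>q. q"] by simp
      then have "[int p * (x ^ f * (x - 1)) = int p - 1] (mod int q)"
        by (intro cong_dvd_modulus[OF x]) simp
      then show ?thesis unfolding R_def by blast
    qed
    then have "p \<in> B f" using p(1) by (simp add: B_def primes_3_mod_4_def)
    then show False using p(3) that by blast
  qed
  then show ?thesis
    using p(1,2) W_ge prime_gt_0_nat[of p] by (intro exI[of _ p] exI[of _ W]) (auto simp: primes_3_mod_4_def)
qed

subsection \<open>The tardy residue class\<close>

text \<open>An odd prime p dividing n contributes the even factor p - 1, so the totient of the
  cofactor is odd and the cofactor is 1 or 2. Without an odd prime factor, n is a power of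
  2.\<close>

lemma totient_2_mod_4_imp:
  assumes n: "n > 0" and tot: "totient n mod 4 = 2"
  shows "\<exists>p f. prime p \<and> totient n = p ^ f * (p - 1)"
proof (cases "\<exists>p. prime p \<and> odd p \<and> p dvd n")
  case True
  then obtain p where p: "prime p" "odd p" "p dvd n" by blast
  then obtain r where r: "n = p ^ multiplicity p n * r" "\<not> p dvd r"
    using multiplicity_decompose'[of n p] n by (metis not_prime_unit less_not_refl2)
  define k where "k = multiplicity p n"
  have k: "k > 0" using p n by (simp add: k_def prime_multiplicity_gt_zero_iff)
  have "coprime (p ^ k) r" using p r by (simp add: prime_imp_coprime)
  then have t: "totient n = p ^ (k - 1) * (p - 1) * totient r"
    using r(1) p(1) k by (metis k_def totient_mult_coprime totient_prime_power)
  have "odd (totient r)"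
  proof
    assume "even (totient r)"
    moreover have "even (p - 1)" using p by simp
    ultimately have "2 * 2 dvd (p - 1) * totient r" by (intro mult_dvd_mono)
    then have "2 * 2 dvd totient n" by (simp add: t mult.assoc)
    then show False using tot by auto
  qed
  then have "r \<le> 2" using totient_even by (meson not_less)
  moreover have "r > 0" using r(1) n by (auto intro: gr0I)
  ultimately have "r = 1 \<or> r = 2" by auto
  then have "totient r = 1" by auto
  with t p(1) show ?thesis by (metis mult.right_neutral)
next
  case False
  obtain r where r: "n = 2 ^ multiplicity 2 n * r" "\<not> 2 dvd r"
    using multiplicity_decompose'[of n "2::nat"] n by auto
  define k where "k = multiplicity 2 n"
  have "r = 1"
  proof (rule ccontr)
    assume "r \<noteq> 1"
    then obtain q where "prime q" "q dvd r" using prime_factor_nat by blast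
    moreover have "odd q" using r(2) \<open>q dvd r\<close> by (meson dvd_trans)
    moreover have "q dvd n" using r(1) \<open>q dvd r\<close> by (metis dvd_mult)
    ultimately show False using False by blast
  qed
  then have n2: "n = 2 ^ k" using r(1) by (simp add: k_def)
  then have "k > 0" using tot by (auto intro: gr0I)
  then have "totient n = 2 ^ (k - 1) * (2 - 1)"
    using n2 totient_prime_power[of 2 k] by simp
  then show ?thesis using two_is_prime_nat by blast
qed

text \<open>Each factor of \<open>m\<close> handles one shape t = q^f (q-1):
  \<open>2 * p - 1\<close> the case f = 0, \<open>W\<close> the case 0 < f < L,
  \<open>(p - 1) ^ 3\<close> the case q = p, and \<open>p ^ 6\<close> the case of large f with q
  different from p. Since m \<le> p^12, it suffices that t \<ge> p^(6L).\<close>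

lemma exists_tardy_class:
  fixes p W L :: nat
  assumes p: "prime p" "p mod 4 = 3" and W: "0 < W" "W < p" and L: "0 < L" "6 * L + 2 \<le> p"
    and un: "\<And>f. 0 < f \<Longrightarrow> f < L \<Longrightarrow> \<not> (\<exists>x::int. [int p * (x ^ f * (x - 1)) = int p - 1] (mod int W))"
  shows "\<exists>a m. W \<le> m \<and> m \<le> p ^ 12 \<and> totients_in_class a m \<noteq> {} \<and>
    (\<forall>t\<in>totients_in_class a m. m ^ L \<le> t ^ 2)"
proof -
  have p3: "p \<ge> 3" using p(2) by presburger
  define V where "V = (p - 1) ^ 3 * (2 * p - 1) * W"
  define m where "m = p ^ 6 * V"
  \<comment> \<open>A multiple of \<open>totient V\<close> is needed for \<open>e + 1\<close> by
    Euler's theorem; the multiple 7 ensures e \<ge> 6, so that p^6 divides \<open>a\<close>.\<close>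
  define e where "e = 7 * totient V - 1"
  define a where "a = p ^ e * (p - 1)"
  have V0: "V > 0" using p3 W by (simp add: V_def)
  have co1: "coprime p (2 * p - 1)"
  proof (rule coprimeI)
    fix c assume c: "c dvd p" "c dvd 2 * p - 1"
    have "c dvd 2 * p - (2 * p - 1)" by (rule dvd_diff_nat[OF dvd_mult[OF c(1)] c(2)])
    moreover have "2 * p - (2 * p - 1) = 1" using p3 by simp
    ultimately show "is_unit c" by simp
  qed
  have "coprime p ((p - 1) ^ 3)" using coprime_diff_one_right_nat[of p] p3 by simp
  moreover have "coprime p W"
    using p(1) W by (intro prime_imp_coprime) (auto dest: dvd_imp_le)
  ultimately have co: "coprime p V" using co1 by (simp add: V_def)
  have "totient V > 0" using V0 by simp
  then have e: "e \<ge> 6" "Suc e = totient V * 7" unfolding e_def by linarith+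
  have "[p ^ totient V = 1] (mod V)" using co by (rule euler_theorem)
  then have "[(p ^ totient V) ^ 7 = 1 ^ 7] (mod V)" by (rule cong_pow)
  then have euler: "[p ^ Suc e = 1] (mod V)" by (simp only: e(2) power_mult power_one)
  have m_ge: "W \<le> m"
  proof -
    have "1 \<le> p ^ 6 * ((p - 1) ^ 3 * (2 * p - 1))" using p3 by (simp add: Suc_leI)
    then have "1 * W \<le> p ^ 6 * ((p - 1) ^ 3 * (2 * p - 1)) * W" by (rule mult_le_mono1)
    then show ?thesis by (simp add: m_def V_def mult.assoc)
  qed
  have m_le: "m \<le> p ^ 12"
  proof -
    have "(p - 1) ^ 3 * (2 * p - 1) * W \<le> p ^ 3 * (p * p) * p"
      using p3 W by (intro mult_le_mono power_mono) (auto intro: order_trans[of _ "2 * p"])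
    also have "\<dots> = p ^ 6" by (simp add: eval_nat_numeral)
    finally have "m \<le> p ^ 6 * p ^ 6" unfolding m_def V_def by (rule mult_le_mono2)
    then show ?thesis by (simp flip: power_add)
  qed
  have "totient (p ^ Suc e) = a" unfolding a_def using p(1) by (rule totient_prime_power_Suc)
  then have "is_totient a" unfolding is_totient_def using p3 by (intro exI[of _ "p ^ Suc e"]) simp
  then have ne: "totients_in_class (int a) m \<noteq> {}" by (auto simp: totients_in_class_def)
  have "m ^ L \<le> t ^ 2" if tc: "t \<in> totients_in_class (int a) m" for t
  proof -
    obtain n where n: "n > 0" "t = totient n" using tc by (auto simp: totients_in_class_def is_totient_def)
    have cong: "[t = a] (mod m)" using tc by (simp add: totients_in_class_def cong_int_iff)
    \<comment> \<open>Multiplication by p expresses that t is congruent to 1 - 1/p without an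
      inverse.\<close>
    have "[p * t = p * a] (mod V)"
      by (rule cong_scalar_left, rule cong_dvd_modulus_nat[OF cong]) (simp add: m_def)
    also have "p * a = p ^ Suc e * (p - 1)" by (simp add: a_def)
    also have "[p ^ Suc e * (p - 1) = 1 * (p - 1)] (mod V)" using euler by (rule cong_scalar_right)
    finally have pt: "[p * t = p - 1] (mod V)" by simp
    have ptd: "[p * t = p - 1] (mod d)" if "d dvd V" for d
      using pt that by (rule cong_dvd_modulus_nat)
    have p6: "p ^ 6 dvd t"
    proof -
      have "[t = a] (mod p ^ 6)" by (rule cong_dvd_modulus_nat[OF cong]) (simp add: m_def)
      moreover have "p ^ 6 dvd a" using e(1) by (simp add: a_def le_imp_power_dvd dvd_mult2)
      ultimately show ?thesis by (simp add: cong_dvd_iff)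
    qed
    have "t mod 4 = 2"
    proof -
      have "4 dvd (p - 1) ^ 3"
      proof -
        have "even (p - 1)" using p(2) by presburger
        then have "2 ^ 3 dvd (p - 1) ^ 3" by (rule dvd_power_same)
        moreover have "(4::nat) dvd 2 ^ 3" by simp
        ultimately show ?thesis by (rule dvd_trans[rotated])
      qed
      then have "4 dvd V" by (simp add: V_def)
      then have "(p * t) mod 4 = (p - 1) mod 4" using ptd by (simp add: cong_def)
      also have "p - 1 = 2 + 4 * (p div 4)" using mult_div_mod_eq[of 4 p] p(2) by linarith
      also have "\<dots> mod 4 = 2" by (simp only: mod_mult_self2) simp
      finally have "(p * t) mod 4 = 2" .
      moreover have "(p * t) mod 4 = (3 * (t mod 4)) mod 4" using mod_mult_eq[of p 4 t] unfolding p(2) by (rule sym)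
      moreover have "t mod 4 \<in> {0, 1, 2, 3}" by auto
      ultimately show ?thesis by auto
    qed
    then obtain q f where q: "prime q" "t = q ^ f * (q - 1)" using totient_2_mod_4_imp n by blast
    have q2: "q \<ge> 2" using q(1) by (rule prime_ge_2_nat)
    have zcong: "[int p * (int q ^ f * (int q - 1)) = int p - 1] (mod int d)" if "d dvd V" for d
    proof -
      have "[int (p * t) = int (p - 1)] (mod int d)" using ptd[OF that] by (simp only: cong_int_iff)
      then show ?thesis using q2 p3 by (simp add: q(2) of_nat_diff)
    qed
    have "p ^ (6 * L) \<le> t"
    proof -
      consider "f = 0" | "0 < f" "f < L" | "L \<le> f" "q = p" | "L \<le> f" "q \<noteq> p" by linarith
      then show ?thesis
      proof cases
        case 1
        \<comment> \<open>Adding the modulus 2p - 1 turns the difference into the product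
          pq.\<close>
        have "int (2 * p - 1) dvd int p * (int q - 1) - (int p - 1)"
          using zcong[of "2 * p - 1"] 1 by (simp add: V_def cong_iff_dvd_diff)
        then have "int (2 * p - 1) dvd int p * (int q - 1) - (int p - 1) + int (2 * p - 1)" by simp
        also have "int p * (int q - 1) - (int p - 1) + int (2 * p - 1) = int (p * q)"
          using p3 by (simp add: of_nat_diff algebra_simps)
        finally have "2 * p - 1 dvd p * q" by (simp only: of_nat_dvd_iff)
        then have "2 * p - 1 dvd q" using co1 by (simp add: coprime_dvd_mult_right_iff coprime_commute)
        then have "2 * p - 1 = q" using q(1) p3 by (auto simp: prime_nat_iff)
        then have "t = 2 * (p - 1)" using q(2) 1 by simp
        moreover have "even (p - 1)" using p(2) by presburger
        ultimately have "t mod 4 = 0" by auto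
        then show ?thesis using \<open>t mod 4 = 2\<close> by simp
      next
        case 2
        then show ?thesis using un zcong[of W] by (auto simp: V_def)
      next
        case 3
        define r where "r = int p - 1"
        have r0: "r \<noteq> 0" using p3 by (simp add: r_def)
        \<comment> \<open>The right side is (p-1)^2 times the geometric sum 1 + p + ... + p^f. Hence
          p - 1 divides that sum, which is f + 1 modulo p - 1.\<close>
        have "int ((p - 1) ^ 3) dvd int p * (int p ^ f * (int p - 1)) - (int p - 1)"
          using zcong[of "(p - 1) ^ 3"] 3 by (simp add: V_def cong_iff_dvd_diff)
        also have "int ((p - 1) ^ 3) = r * (r * r)" using p3 by (simp add: r_def of_nat_diff power3_eq_cube)
        also have "int p * (int p ^ f * (int p - 1)) - (int p - 1) = r * (int p ^ Suc f - 1)"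
          by (simp add: r_def algebra_simps)
        also have "int p ^ Suc f - 1 = r * (\<Sum>i<Suc f. int p ^ i)"
          unfolding r_def by (rule power_diff_1_eq)
        finally have "r dvd (\<Sum>i<Suc f. int p ^ i)" using r0 by simp
        moreover have "[(\<Sum>i<Suc f. int p ^ i) = (\<Sum>i<Suc f. 1 ^ i)] (mod r)"
          by (intro cong_sum cong_pow) (simp add: r_def cong_iff_dvd_diff)
        ultimately have "r dvd (\<Sum>i<Suc f. 1 ^ i)" by (simp add: cong_dvd_iff)
        then have "r dvd int (Suc f)" by simp
        then have "r \<le> int (Suc f)" by (rule zdvd_imp_le) simp
        then have "6 * L \<le> f" using L by (simp add: r_def)
        then have "p ^ (6 * L) \<le> p ^ f" using p3 by (intro power_increasing) auto
        also have "\<dots> \<le> t" using q(2) q2 3 by simp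
        finally show ?thesis .
      next
        case 4
        \<comment> \<open>All of p^6 has to divide q - 1, so q is larger than p^6 and q^L already
          suffices.\<close>
        have "coprime (p ^ 6) (q ^ f)" using p(1) q(1) 4 by (simp add: primes_coprime)
        then have "p ^ 6 dvd q - 1" using p6 q(2) by (simp add: coprime_dvd_mult_right_iff)
        then have "p ^ 6 \<le> q - 1" using q2 by (intro dvd_imp_le) auto
        then have "(p ^ 6) ^ L \<le> q ^ L" by (intro power_mono) auto
        also have "\<dots> \<le> q ^ f" using 4 q2 by (intro power_increasing) auto
        also have "\<dots> \<le> t" using q(2) q2 by simp
        finally show ?thesis by (simp add: power_mult)
      qed
    qed
    then have "(p ^ (6 * L)) ^ 2 \<le> t ^ 2" by (rule power_mono) simp
    moreover have "m ^ L \<le> (p ^ 12) ^ L" using m_le by (rule power_mono) simp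
    ultimately show ?thesis by (simp add: power_mult[symmetric] mult.commute mult.left_commute)
  qed
  with m_ge m_le ne show ?thesis by blast
qed

section \<open>Size estimates and the sequence of progressions\<close>

lemma thousand_pow4_le_two_power:
  assumes "L \<ge> 30"
  shows "1000 * L ^ 4 \<le> (2::nat) ^ L"
  using assms
proof (induction L rule: dec_induct)
  case base
  then show ?case by simp
next
  case (step L)
  define C D where "C = L * (L * L)" and "D = L * L"
  have "Suc L ^ 4 = L * C + 4 * C + 6 * D + 4 * L + 1"
    by (simp add: C_def D_def eval_nat_numeral algebra_simps)
  moreover have "30 * C \<le> L * C" "30 * D \<le> C" "30 * L \<le> D"
    using step.hyps by (simp_all only: C_def D_def mult_le_mono1)
  ultimately have "Suc L ^ 4 \<le> 2 * (L * C)" using step.hyps by linarith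
  then have "1000 * Suc L ^ 4 \<le> 2 * (1000 * L ^ 4)" by (simp add: C_def power4_eq_xxxx mult.assoc)
  also have "\<dots> \<le> 2 * 2 ^ L" using step.IH by (rule mult_le_mono2)
  finally show ?case by simp
qed

text \<open>The upper bound on m gives loglog m \<le> L + 5 \<le> L^2. The lower bound makes
  logloglog m at least 1, so dividing by it only decreases the quotient.\<close>

lemma sqrt_loglog_le:
  fixes m L :: nat
  assumes L: "L \<ge> 6" and m: "3 ^ 27 \<le> m" "m \<le> 2 ^ (12 * 2 ^ Suc L)"
  shows "sqrt (ln (ln (real m)) / ln (ln (ln (real m)))) \<le> real L"
proof -
  \<comment> \<open>From e \<le> 3 alone: e^e is at most 3^3 = 27, and e^27 is at most 3^27.\<close>
  have "exp (exp (exp 1)) \<le> (3::real) ^ 27"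
  proof -
    have e3: "exp (real n) \<le> 3 ^ n" for n
    proof -
      have "exp (real n) = exp 1 ^ n" by (simp flip: exp_of_nat_mult)
      also have "\<dots> \<le> 3 ^ n" using exp_le by (intro power_mono) auto
      finally show ?thesis .
    qed
    have "exp (exp 1) \<le> exp (real 3)" using exp_le by simp
    also have "\<dots> \<le> 27" using e3[of 3] by simp
    finally have "exp (exp (exp 1)) \<le> exp (real 27)" by simp
    then show ?thesis using e3[of 27] by linarith
  qed
  also have "\<dots> = real (3 ^ 27)" by simp
  also have "\<dots> \<le> real m" using m(1) by (simp only: of_nat_le_iff)
  finally have "exp (exp (exp 1)) \<le> real m" .
  then have 1: "exp (exp 1) \<le> ln (real m)" by (metis exp_gt_zero less_le_trans ln_exp ln_mono)
  then have 2: "exp 1 \<le> ln (ln (real m))" by (metis exp_gt_zero less_le_trans ln_exp ln_mono)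
  then have 3: "1 \<le> ln (ln (ln (real m)))" by (metis exp_gt_zero less_le_trans ln_exp ln_mono)
  have "real m \<le> real (2 ^ (12 * 2 ^ Suc L))" using m(2) by (simp only: of_nat_le_iff)
  moreover have "0 < real m" using m(1) by (simp add: gr0I)
  ultimately have "ln (real m) \<le> ln (2 ^ (12 * 2 ^ Suc L))" by simp
  also have "\<dots> = real (12 * 2 ^ Suc L) * ln 2" by (simp add: ln_realpow)
  also have "\<dots> \<le> real (12 * 2 ^ Suc L) * 1"
    using ln_2_less_1 by (intro mult_left_mono) auto
  also have "\<dots> \<le> 2 ^ (L + 5)" by (simp add: power_add)
  finally have "ln (ln (real m)) \<le> ln (2 ^ (L + 5))"
    using less_le_trans[OF exp_gt_zero 1] by (intro ln_mono) auto
  also have "\<dots> = real (L + 5) * ln 2" by (simp add: ln_realpow)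
  also have "\<dots> \<le> real (L + 5) * 1"
    using ln_2_less_1 by (intro mult_left_mono) auto
  also have "\<dots> \<le> real L * real L"
  proof -
    have "L + 5 \<le> L * L" using mult_le_mono1[OF L, of L] L by linarith
    then show ?thesis by (simp flip: of_nat_mult)
  qed
  finally have "ln (ln (real m)) \<le> real L ^ 2" by (simp add: power2_eq_square)
  moreover have "ln (ln (real m)) / ln (ln (ln (real m))) \<le> ln (ln (real m))"
    using frac_le[OF _ order_refl _ 3, of "ln (ln (real m))"] less_le_trans[OF exp_gt_zero 2] by simp
  ultimately have "ln (ln (real m)) / ln (ln (ln (real m))) \<le> real L ^ 2" by linarith
  then show ?thesis by (rule real_le_lsqrt[rotated]) simp
qed

text \<open>From m^L \<le> t^2 the least totient is at least m^(L/2), and \<open>L\<close> dominates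
  the square root in the exponent.\<close>

lemma exists_tardy_class_above:
  "\<exists>a m. B \<le> m \<and> 0 < m \<and> totients_in_class a m \<noteq> {} \<and>
    real (least_totient a m) \<ge> real m powr (1 / 2 * sqrt (ln (ln (real m)) / ln (ln (ln (real m)))))"
proof -
  \<comment> \<open>With L the integer part of the binary logarithm of i, L0 \<le> L \<le> W \<le>
    m, so m exceeds both \<open>B\<close> and the threshold of
    \<open>sqrt_loglog_le\<close>.\<close>
  define L0 where "L0 = max B (3 ^ 27)"
  obtain i where i: "2 ^ L0 \<le> i" "real (card (primes_3_mod_4 (2 ^ i))) * real (i + 1) ^ 2 > 2 ^ i"
    using primes_3_mod_4_dense by blast
  have "i \<ge> 1" using i(1) by (metis one_le_numeral one_le_power order_trans)
  then obtain L where L: "2 ^ L \<le> i" "i < 2 ^ Suc L"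
    using ex_power_ivl1[of 2 i] by auto
  have "(2::nat) ^ L0 < 2 ^ Suc L" using i(1) L(2) by (rule le_less_trans)
  then have "L0 < Suc L" by (rule power_less_imp_less_exp[rotated]) simp
  then have "L0 \<le> L" by simp
  then have LB: "B \<le> L" "3 ^ 27 \<le> L" by (simp_all add: L0_def)
  then have L30: "L \<ge> 30" by simp
  obtain p W where pW: "prime p" "p mod 4 = 3" "p \<le> 2 ^ i" "W < p" "6 * L + 2 \<le> W"
    "\<And>f. 0 < f \<Longrightarrow> f < L \<Longrightarrow> \<not> (\<exists>x::int. [int p * (x ^ f * (x - 1)) = int p - 1] (mod int W))"
    using exists_prime_unattained[OF _ thousand_pow4_le_two_power[OF L30] L i(2)] L30 by auto
  have "0 < W" "0 < L" "6 * L + 2 \<le> p" using pW(4,5) L30 by linarith+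
  from exists_tardy_class[OF pW(1,2) this(1) pW(4) this(2,3) pW(6)]
  obtain a m where am: "W \<le> m" "m \<le> p ^ 12" "totients_in_class a m \<noteq> {}"
    "\<And>t. t \<in> totients_in_class a m \<Longrightarrow> m ^ L \<le> t ^ 2"
    by blast
  define t where "t = least_totient a m"
  have "t \<in> totients_in_class a m"
    using am(3) unfolding t_def least_totient_def by (metis LeastI all_not_in_conv)
  then have t: "m ^ L \<le> t ^ 2" by (rule am(4))
  have "L \<le> m" using pW(5) am(1) by linarith
  have "m \<le> 2 ^ (12 * 2 ^ Suc L)"
  proof -
    have "p ^ 12 \<le> (2 ^ i) ^ 12" using pW(3) by (rule power_mono) simp
    also have "\<dots> = 2 ^ (12 * i)" by (simp add: power_mult[symmetric] mult.commute)
    also have "\<dots> \<le> 2 ^ (12 * 2 ^ Suc L)" using L(2) by (intro power_increasing) auto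
    finally show ?thesis using am(2) by (rule order_trans[rotated])
  qed
  then have s: "sqrt (ln (ln (real m)) / ln (ln (ln (real m)))) \<le> real L"
    using LB \<open>L \<le> m\<close> L30 by (intro sqrt_loglog_le) auto
  have "real m \<ge> 1" using \<open>L \<le> m\<close> L30 by simp
  then have "real m powr (1 / 2 * sqrt (ln (ln (real m)) / ln (ln (ln (real m))))) \<le> real m powr (1 / 2 * real L)"
    using s by (intro powr_mono) auto
  also have "\<dots> = (real m powr real L) powr (1 / 2)" by (simp add: powr_powr mult.commute)
  also have "\<dots> = sqrt (real m ^ L)" using \<open>real m \<ge> 1\<close> by (simp add: powr_realpow powr_half_sqrt)
  also have "\<dots> \<le> sqrt (real t ^ 2)"
  proof (rule real_sqrt_le_mono)
    have "real (m ^ L) \<le> real (t ^ 2)" using t by (simp only: of_nat_le_iff)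
    then show "real m ^ L \<le> real t ^ 2" by simp
  qed
  also have "\<dots> = real t" by simp
  finally have "real m powr (1 / 2 * sqrt (ln (ln (real m)) / ln (ln (ln (real m))))) \<le> real t" .
  then show ?thesis using am(3) LB(1) \<open>L \<le> m\<close> L30
    by (intro exI[of _ a] exI[of _ m]) (auto simp: t_def)
qed

theorem theorem1:
  shows "\<exists>c0::real. c0 > 0 \<and>
    (\<exists>(a :: nat \<Rightarrow> int) (m :: nat \<Rightarrow> nat).
       (\<forall>k\<ge>1. m k > 0) \<and>
       filterlim m at_top sequentially \<and>
       (\<forall>k\<ge>1. totients_in_class (a k) (m k) \<noteq> {}) \<and>
       (\<exists>\<epsilon> :: nat \<Rightarrow> real. \<epsilon> \<longlonglongrightarrow> 0 \<and>
          (\<forall>\<^sub>F k in sequentially.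
             real (least_totient (a k) (m k)) \<ge>
               real (m k) powr ((c0 + \<epsilon> k) *
                 sqrt (ln (ln (real (m k))) / ln (ln (ln (real (m k)))))))))"
proof -
  obtain a m where am: "\<And>k. k \<le> m k" "\<And>k. 0 < m k" "\<And>k. totients_in_class (a k) (m k) \<noteq> {}"
    "\<And>k. real (least_totient (a k) (m k)) \<ge>
      real (m k) powr (1 / 2 * sqrt (ln (ln (real (m k))) / ln (ln (ln (real (m k))))))"
    using exists_tardy_class_above by metis
  have "filterlim m at_top sequentially"
    by (rule filterlim_at_top_mono[OF filterlim_ident]) (use am(1) in auto)
  \<comment> \<open>The constant is 1/2 and the error term is identically 0; m k \<ge> k gives the
    divergence of the moduli.\<close>
  with am(2-4) show ?thesis
    by (intro exI[of _ "1 / 2"] conjI exI[of _ a] exI[of _ m] exI[of _ "\<lambda>_. 0"]) auto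
qed

end
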